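(* Let $s \geq 6$ and $N$ be positive integers, and let $A=\{0=a_1, a_2,\ldots, a_s \} \subseteq \{0,1,\ldots,N-1\}$ be a set of $s$ distinct integers with $\gcd(a_2, \ldots, a_s)=1$. Let $x_1, \ldots, x_s$ be integers such that for all indices $i,j,k,l\in\{1,\ldots,s\}$, $$a_j-a_i=a_k-a_l \implies x_j-x_i=x_k-x_l.$$ If $|A+A|<\frac{5}{2}s$, then there exist integers $x,y$ such that $x_i=a_ix+y$ for each $i=1,\ldots,s$.
   Context: $A+A=\{a+b: a,b\in A\}$. *)

theory Defs
  imports Complex_Main "HOL-Library.Set_Algebras"
begin

end

theory Submission
  imports Defs
begin

text \<open>
  If \<open>x\<close>, read as a function \<open>f\<close> on \<open>A\<close>, is not affine, then \<open>a \<mapsto> (a, f a)\<close> identifies \<open>A + A\<close> with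
  the sumset of a planar set that is not contained in a line, so Freiman's lemma in dimension two
  gives \<open>|A + A| \<ge> 3s - 3 \<ge> 5s/2\<close>. Freiman's lemma is proved by removing \<open>v = Max A\<close>: if the points
  left are collinear, then all sums with \<open>v\<close> are new; otherwise the sums of \<open>v\<close> with itself and with
  its nearest points in the directions of maximal and minimal slope are new. So \<open>f\<close> is affine over
  the rationals, and the gcd condition makes it affine over the integers.
\<close>

definition freiman_hom :: "int set \<Rightarrow> (int \<Rightarrow> int) \<Rightarrow> bool" where
  "freiman_hom A f \<longleftrightarrow>
     (\<forall>a\<in>A. \<forall>b\<in>A. \<forall>c\<in>A. \<forall>d\<in>A. a + b = c + d \<longrightarrow> f a + f b = f c + f d)"

text \<open>Collinearity of the points \<open>(a, f a)\<close>: a line of slope \<open>p / q\<close>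
  with denominators cleared, so that everything stays in the integers.\<close>

definition rat_affine_on :: "int set \<Rightarrow> (int \<Rightarrow> int) \<Rightarrow> bool" where
  "rat_affine_on A f \<longleftrightarrow> (\<exists>p q r. q \<noteq> 0 \<and> (\<forall>a\<in>A. q * f a = p * a + r))"

definition slope :: "(int \<Rightarrow> int) \<Rightarrow> int \<Rightarrow> int \<Rightarrow> rat" where
  "slope f v b = of_int (f v - f b) / of_int (v - b)"

lemma freiman_homD:
  assumes "freiman_hom A f" "a \<in> A" "b \<in> A" "c \<in> A" "d \<in> A" "a + b = c + d"
  shows "f a + f b = f c + f d"
  using assms unfolding freiman_hom_def by blast

lemma freiman_hom_subset: "freiman_hom B f \<Longrightarrow> A \<subseteq> B \<Longrightarrow> freiman_hom A f"
  unfolding freiman_hom_def by (meson subsetD)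

lemma freiman_hom_uminus: "freiman_hom A f \<Longrightarrow> freiman_hom A (\<lambda>a. - f a)"
  unfolding freiman_hom_def by (smt (verit))

lemma slope_uminus: "slope (\<lambda>a. - f a) v b = - slope f v b"
  by (simp add: slope_def flip: of_int_minus divide_minus_left)

lemma slope_mult: "b < v \<Longrightarrow> slope f v b * of_int (v - b) = of_int (f v - f b)"
  by (simp add: slope_def)

text \<open>All chords from \<open>(v, f v)\<close> having the same slope means that all points lie
  on one line through it; writing \<open>m\<close> as a fraction supplies \<open>p\<close> and
  \<open>q\<close>.\<close>

lemma rat_affine_on_const_slope:
  assumes lt: "\<And>a. a \<in> A \<Longrightarrow> a < v" and const: "\<And>a. a \<in> A \<Longrightarrow> slope f v a = m"
  shows "rat_affine_on (insert v A) f"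
proof -
  obtain p q where q: "q > 0" and m: "m = of_int p / of_int q"
    by (metis quotient_of_denom_pos quotient_of_div surj_pair)
  have "q * f a = p * a + (q * f v - p * v)" if "a \<in> A" for a
  proof -
    have "of_int p / of_int q * of_int (v - a) = (of_int (f v - f a) :: rat)"
      using slope_mult[OF lt[OF that], of f] const[OF that] m by simp
    then have "of_int p * of_int (v - a) = (of_int q * of_int (f v - f a) :: rat)"
      using q by (simp add: field_simps)
    then have "p * (v - a) = q * (f v - f a)"
      by (simp only: of_int_mult[symmetric] of_int_eq_iff)
    then show ?thesis by (simp add: algebra_simps)
  qed
  then show ?thesis
    unfolding rat_affine_on_def using q
    by (intro exI[of _ p] exI[of _ q] exI[of _ "q * f v - p * v"]) auto
qed

text \<open>The translates of \<open>A\<close> by its minimum and by its maximum can share only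
  \<open>Min A + Max A\<close>.\<close>

lemma card_sumset_ge:
  fixes A :: "int set"
  assumes "finite A" "A \<noteq> {}"
  shows "card (A + A) \<ge> 2 * card A - 1"
proof -
  let ?L = "(+) (Min A) ` A" and ?U = "(+) (Max A) ` A"
  have "?L \<inter> ?U \<subseteq> {Min A + Max A}"
  proof
    fix z assume "z \<in> ?L \<inter> ?U"
    then obtain b c where "b \<in> A" "c \<in> A" "z = Min A + b" "z = Max A + c" by blast
    moreover have "b \<le> Max A" "Min A \<le> c" using calculation assms by auto
    ultimately show "z \<in> {Min A + Max A}" by auto
  qed
  then have "card (?L \<inter> ?U) \<le> 1"
    using card_mono[of "{Min A + Max A}"] by simp
  moreover have "card ?L = card A" "card ?U = card A"
    by (auto intro!: card_image)
  moreover have "card ?L + card ?U = card (?L \<union> ?U) + card (?L \<inter> ?U)"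
    using assms by (intro card_Un_Int) auto
  moreover have "?L \<union> ?U \<subseteq> A + A" using assms by (auto intro!: set_plus_intro Min_in Max_in)
  then have "card (?L \<union> ?U) \<le> card (A + A)"
    using assms by (intro card_mono finite_set_plus)
  ultimately show ?thesis by linarith
qed

text \<open>The line of slope \<open>M\<close> through \<open>(v, f v)\<close> supports the point
  set: no point lies below it. A sum of two points on the line can only be a sum of points on the
  line, and with \<open>u\<close> nearest to \<open>v\<close> there, \<open>v + u\<close> is too
  large for two points of \<open>A\<close>.\<close>

lemma extremal_slope_sum_new:
  assumes fin: "finite A" and ne: "A \<noteq> {}" and lt: "\<And>a. a \<in> A \<Longrightarrow> a < v"
    and hom: "freiman_hom (insert v A) f"
  obtains u where "u \<in> A" "v + u \<notin> A + A" "\<And>b. b \<in> A \<Longrightarrow> slope f v b \<le> slope f v u"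
proof -
  define M where "M = Max (slope f v ` A)"
  define T where "T = {b \<in> A. slope f v b = M}"
  have M: "slope f v b \<le> M" if "b \<in> A" for b using fin that by (simp add: M_def)
  have "M \<in> slope f v ` A" unfolding M_def using fin ne by (intro Max_in) auto
  then have T: "finite T" "T \<noteq> {}" using fin by (auto simp: T_def)
  define u where "u = Max T"
  have u: "u \<in> A" "slope f v u = M" using Max_in[OF T] by (auto simp: u_def T_def)
  have "v + u \<notin> A + A"
  proof
    assume "v + u \<in> A + A"
    then obtain b c where bc: "b \<in> A" "c \<in> A" "v + u = b + c" by (auto elim: set_plus_elim)
    have f: "f v + f u = f b + f c" using freiman_homD[OF hom] bc u by blast
    have up: "of_int (f v - f d) \<le> M * of_int (v - d)" if "d \<in> A" for d
      using mult_right_mono[OF M[OF that], of "of_int (v - d)"] slope_mult[OF lt[OF that], of f] lt[OF that]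
      by (simp del: of_int_diff)
    have on_edge: "d \<le> u" if "d \<in> A" "M * of_int (v - d) \<le> of_int (f v - f d)" for d
    proof -
      have "of_int (f v - f d) = M * of_int (v - d)" using up[OF that(1)] that(2) by simp
      then have "slope f v d = M" using lt[OF that(1)] by (simp add: slope_def)
      then show ?thesis using T that by (auto simp: u_def T_def)
    qed
    have "M * of_int (v - u) = of_int (f v - f u)" using slope_mult[OF lt[OF u(1)], of f] u by simp
    moreover have "f v - f u = (f v - f b) + (f v - f c)" "v - u = (v - b) + (v - c)"
      using f bc by auto
    \<comment> \<open>Two inequalities from \<open>up\<close> add up to an equality, so both are
      equalities and \<open>b\<close>, \<open>c\<close> lie on the supporting line.\<close>
    ultimately have "M * of_int (v - b) + M * of_int (v - c) = of_int (f v - f b) + of_int (f v - f c)"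
      by (metis distrib_left of_int_add)
    then have "b \<le> u" "c \<le> u" using up[OF bc(1)] up[OF bc(2)] on_edge bc by auto
    then show False using bc lt[OF u(1)] by linarith
  qed
  then show ?thesis using that u M by metis
qed

lemma freiman_lemma_dim2:
  assumes "finite A" "freiman_hom A f" "\<not> rat_affine_on A f"
  shows "card (A + A) + 3 \<ge> 3 * card A"
  using assms
proof (induction A rule: finite_linorder_max_induct)
  case empty
  then show ?case by simp
next
  case (insert v A)
  note lt = insert.hyps(2)[rule_format] and fin = insert.hyps(1)
    and hom = insert.prems(1) and naff = insert.prems(2)
  have fin2: "finite (insert v A + insert v A)" using fin by (intro finite_set_plus) auto
  have card_v: "card (insert v A) = Suc (card A)" using fin lt by (metis card_insert_disjoint less_irrefl)
  have ne: "A \<noteq> {}"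
  proof
    assume "A = {}"
    then have "rat_affine_on (insert v A) f" by (intro rat_affine_on_const_slope) auto
    then show False using naff by simp
  qed
  have vv: "v + v \<notin> A + A"
  proof
    assume "v + v \<in> A + A"
    then obtain b c where "b \<in> A" "c \<in> A" "v + v = b + c" by (auto elim: set_plus_elim)
    then show False using lt[of b] lt[of c] by linarith
  qed
  show ?case
  proof (cases "rat_affine_on A f")
    case True
    then obtain p q r where q: "q \<noteq> 0" and line: "\<And>a. a \<in> A \<Longrightarrow> q * f a = p * a + r"
      unfolding rat_affine_on_def by blast
    have off: "q * f v \<noteq> p * v + r"
      using naff q line unfolding rat_affine_on_def by blast
    \<comment> \<open>The functional \<open>q * f a - p * a - r\<close> vanishes on \<open>A\<close>
      but not at \<open>v\<close>, and it would have to respect the relation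
      \<open>v + c = b + d\<close>.\<close>
    have vA: "v + c \<notin> A + A" if "c \<in> A" for c
    proof
      assume "v + c \<in> A + A"
      then obtain b d where bd: "b \<in> A" "d \<in> A" "v + c = b + d" by (auto elim: set_plus_elim)
      then have "f v + f c = f b + f d" using freiman_homD[OF hom] that by blast
      then have "q * f v + q * f c = q * f b + q * f d" by (metis distrib_left)
      moreover have "p * v + p * c = p * b + p * d" using bd by (metis distrib_left)
      ultimately show False using off line[OF that] line[OF bd(1)] line[OF bd(2)] by linarith
    qed
    have disj: "(A + A) \<inter> (+) v ` insert v A = {}" using vA vv by auto
    have "card (A + A) + card ((+) v ` insert v A) = card ((A + A) \<union> (+) v ` insert v A)"
      using disj fin by (intro card_Un_disjoint[symmetric]) (auto intro: finite_set_plus)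
    also have "\<dots> \<le> card (insert v A + insert v A)"
      by (intro card_mono fin2) (auto simp: set_plus_def)
    also have "card ((+) v ` insert v A) = Suc (card A)" using card_v by (subst card_image) auto
    \<comment> \<open>The count is
      \<open>(2 * card A - 1) + (card A + 1) = 3 * card (insert v A) - 3\<close>.\<close>
    finally show ?thesis using card_sumset_ge[OF fin ne] card_v by linarith
  next
    case False
    obtain u where u: "u \<in> A" "v + u \<notin> A + A" "\<And>b. b \<in> A \<Longrightarrow> slope f v b \<le> slope f v u"
      using extremal_slope_sum_new[OF fin ne lt hom] by metis
    \<comment> \<open>Negating \<open>f\<close> turns the maximal slope into the minimal
      one.\<close>
    obtain w where w: "w \<in> A" "v + w \<notin> A + A"
        "\<And>b. b \<in> A \<Longrightarrow> slope (\<lambda>a. - f a) v b \<le> slope (\<lambda>a. - f a) v w"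
      using extremal_slope_sum_new[OF fin ne lt freiman_hom_uminus[OF hom]] by metis
    have "u \<noteq> w"
    proof
      assume "u = w"
      then have "slope f v b = slope f v u" if "b \<in> A" for b
        using u(3)[OF that] w(3)[OF that] by (simp add: slope_uminus)
      then show False using naff rat_affine_on_const_slope[OF lt] by blast
    qed
    moreover have "u \<noteq> v" "w \<noteq> v" using lt u(1) w(1) by blast+
    ultimately have card3: "card {v + v, v + u, v + w} = 3" by simp
    have "(A + A) \<inter> {v + v, v + u, v + w} = {}" using vv u w by blast
    then have "card (A + A) + card {v + v, v + u, v + w} = card ((A + A) \<union> {v + v, v + u, v + w})"
      using fin by (intro card_Un_disjoint[symmetric]) (auto intro: finite_set_plus)
    also have "\<dots> \<le> card (insert v A + insert v A)"
      using u w by (intro card_mono fin2) (auto simp: set_plus_def)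
    finally have "card (A + A) + 3 \<le> card (insert v A + insert v A)" unfolding card3 .
    moreover have "card (A + A) + 3 \<ge> 3 * card A"
      using insert.IH False freiman_hom_subset[OF hom] by blast
    ultimately show ?thesis using card_v by linarith
  qed
qed

theorem theorem7:
  fixes s N :: nat and A :: "int set" and a x :: "nat \<Rightarrow> int"
  assumes "s \<ge> 6" and "N > 0"
    and "A = a ` {1..s}" and "inj_on a {1..s}" and "a 1 = 0"
    and "A \<subseteq> {0..int N - 1}"
    and "Gcd (a ` {2..s}) = 1"
    and "\<And>i j k l. i \<in> {1..s} \<Longrightarrow> j \<in> {1..s} \<Longrightarrow> k \<in> {1..s} \<Longrightarrow> l \<in> {1..s} \<Longrightarrow>
           a j - a i = a k - a l \<Longrightarrow> x j - x i = x k - x l"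
    and "real (card (A + A)) < 5 / 2 * real s"
  shows "\<exists>u v :: int. \<forall>i\<in>{1..s}. x i = a i * u + v"
proof -
  let ?I = "{1..s}"
  define f where "f = x \<circ> inv_into ?I a"
  have f_a: "f (a i) = x i" if "i \<in> ?I" for i
    using that assms(4) by (simp add: f_def)
  have one: "1 \<in> ?I" using assms(1) by simp
  have "freiman_hom A f"
    unfolding freiman_hom_def assms(3) ball_simps
  proof (intro ballI impI)
    fix i j k l assume *: "i \<in> ?I" "j \<in> ?I" "k \<in> ?I" "l \<in> ?I" "a i + a j = a k + a l"
    then have "x j - x l = x k - x i" by (intro assms(8)) auto
    then show "f (a i) + f (a j) = f (a k) + f (a l)" using * by (simp add: f_a)
  qed
  moreover have "finite A" "card A = s" using assms(3,4) by (auto simp: card_image)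
  \<comment> \<open>Here \<open>s \<ge> 6\<close> enters: it is equivalent to
    \<open>5/2 * s + 3 \<le> 3 * s\<close>.\<close>
  moreover have "card (A + A) + 3 < 3 * s" using assms(1,9) by linarith
  ultimately have "rat_affine_on A f" using freiman_lemma_dim2[of A f] by force
  then obtain p q r where q: "q \<noteq> 0" and line: "\<And>i. i \<in> ?I \<Longrightarrow> q * x i = p * a i + r"
    unfolding rat_affine_on_def assms(3) by (auto simp: f_a)
  have diff: "q * (x i - x 1) = p * a i" if "i \<in> ?I" for i
    using line[OF that] line[OF one] assms(5) by (simp add: algebra_simps)
  \<comment> \<open>Since \<open>q\<close> divides every \<open>p * a i\<close>, it divides
    \<open>p\<close> times the gcd of the \<open>a i\<close>, which is \<open>p\<close> up to sign;
    hence the slope \<open>p / q\<close> is an integer.\<close>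
  have "q dvd Gcd ((*) p ` a ` {2..s})"
    by (rule Gcd_greatest) (auto simp flip: diff)
  also have "\<dots> = normalize p" using assms(7) by (simp add: Gcd_mult)
  finally obtain u where u: "p = q * u" by auto
  have "x i = a i * u + x 1" if "i \<in> ?I" for i
  proof -
    have "q * (x i - x 1) = q * (a i * u)" using diff[OF that] u by (simp add: mult_ac)
    then show ?thesis using q by simp
  qed
  then show ?thesis by blast
qed

end
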